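(* Let $A_i\in\mathbb{R}^{D\times d_i}$ ($i=1,2$) have orthonormal columns, let $\omega_1,\omega_2>0$ with $\omega_1+\omega_2=1$, and let $c_1,c_2>0$. For $W\in\mathbb{R}^{D\times k}$ with $W^\top W=I_k$, let $$\Gamma_k(W)=\sum_{i=1}^2\omega_ic_i\|P_W^\perp A_i\|_F^2,\qquad P_W^\perp:=I_D-WW^\top.$$ Set $M_{\rm mix}:=\sum_{i=1}^2\omega_ic_iA_iA_i^\top$, with eigenvalues $\lambda_1(M_{\rm mix})\ge\cdots\ge\lambda_D(M_{\rm mix})\ge0$. Then for any $k\in\{\max(d_1,d_2),\dots,D\}$, $$\inf_{W:\,W^\top W=I_k}\Gamma_k(W)=\operatorname{Tr}(M_{\rm mix})-\sum_{j=1}^k\lambda_j(M_{\rm mix})=\sum_{j=k+1}^D\lambda_j(M_{\rm mix}).$$ The infimum is attained by any $W_k$ whose columns (orthonormal) span a top-$k$ eigenspace of $M_{\rm mix}$. In particular, the optimal residual is nonincreasing in $k$, and it vanishes if $\operatorname{span}(A_1)+\operatorname{span}(A_2)\subseteq\operatorname{span}(W_k)$.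
   Context: $\|\cdot\|_F$ is the Frobenius norm and $\operatorname{span}(A)$ denotes the column space of a matrix $A$. A top-$k$ eigenspace of a symmetric matrix is a $k$-dimensional subspace spanned by orthonormal eigenvectors associated with its $k$ largest eigenvalues (counted with multiplicity). *)

theory Defs
  imports
    "HOL-Computational_Algebra.Polynomial"
    "Jordan_Normal_Form.Char_Poly"
    "Jordan_Normal_Form.VS_Connect"
begin

definition frobenius_norm :: "real mat \<Rightarrow> real" where
  "frobenius_norm A = sqrt (\<Sum>i<dim_row A. \<Sum>j<dim_col A. (A $$ (i, j))\<^sup>2)"

definition mat_trace :: "real mat \<Rightarrow> real" where
  "mat_trace A = (\<Sum>i<dim_row A. A $$ (i, i))"

abbreviation column_space :: "real mat \<Rightarrow> real vec set" where
  "column_space A \<equiv> vec_space.col_space (dim_row A) A"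

definition orthonormal_list :: "real vec list \<Rightarrow> bool" where
  "orthonormal_list vs \<longleftrightarrow>
     (\<forall>i<length vs. \<forall>j<length vs. vs ! i \<bullet> vs ! j = (if i = j then 1 else 0))"

text \<open>The real eigenvalues, repeated according to algebraic multiplicity, in nonincreasing
  order.  A real symmetric matrix has as many of them as it has rows.\<close>

definition eigenvalues_desc :: "real mat \<Rightarrow> real list" where
  "eigenvalues_desc M = rev (sorted_list_of_multiset (proots (char_poly M)))"

text \<open>The index is 1-based; the value is only meaningful for
  \<open>1 \<le> j \<le> length (eigenvalues_desc M)\<close>.\<close>

definition nth_eigenvalue :: "real mat \<Rightarrow> nat \<Rightarrow> real" where
  "nth_eigenvalue M j = eigenvalues_desc M ! (j - 1)"

text \<open>If there are ties at the \<open>k\<close>-th eigenvalue, several subspaces are top eigenspaces.\<close>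

definition top_eigenspace :: "real mat \<Rightarrow> nat \<Rightarrow> real vec set \<Rightarrow> bool" where
  "top_eigenspace M k S \<longleftrightarrow>
     (\<exists>us. length us = k \<and> set us \<subseteq> carrier_vec (dim_row M) \<and> orthonormal_list us \<and>
           (\<forall>j\<in>{1..k}. eigenvector M (us ! (j - 1)) (nth_eigenvalue M j)) \<and>
           S = LinearCombinations.module.span class_ring (module_vec TYPE(real) (dim_row M)) (set us))"

definition stiefel :: "nat \<Rightarrow> nat \<Rightarrow> real mat set" where
  "stiefel D k = {W \<in> carrier_mat D k. transpose_mat W * W = 1\<^sub>m k}"

definition proj_perp :: "real mat \<Rightarrow> real mat" where
  "proj_perp W = 1\<^sub>m (dim_row W) - W * transpose_mat W"

text \<open>The families \<open>\<omega>\<close>, \<open>c\<close> and \<open>A\<close> are only used at the indices 1 and 2.\<close>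

definition residual ::
  "(nat \<Rightarrow> real) \<Rightarrow> (nat \<Rightarrow> real) \<Rightarrow> (nat \<Rightarrow> real mat) \<Rightarrow> real mat \<Rightarrow> real" where
  "residual \<omega> c A W = (\<Sum>i\<in>{1, 2}. \<omega> i * c i * (frobenius_norm (proj_perp W * A i))\<^sup>2)"

definition mix_matrix ::
  "(nat \<Rightarrow> real) \<Rightarrow> (nat \<Rightarrow> real) \<Rightarrow> (nat \<Rightarrow> real mat) \<Rightarrow> real mat" where
  "mix_matrix \<omega> c A =
     (\<omega> 1 * c 1) \<cdot>\<^sub>m (A 1 * transpose_mat (A 1)) + (\<omega> 2 * c 2) \<cdot>\<^sub>m (A 2 * transpose_mat (A 2))"

definition optimal_residual ::
  "(nat \<Rightarrow> real) \<Rightarrow> (nat \<Rightarrow> real) \<Rightarrow> (nat \<Rightarrow> real mat) \<Rightarrow> nat \<Rightarrow> nat \<Rightarrow> real" where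
  "optimal_residual \<omega> c A D k = (INF W\<in>stiefel D k. residual \<omega> c A W)"

end

theory Submission
  imports Defs
begin

text \<open>For \<open>W\<^sup>T W = I\<close> the residual equals \<open>Tr M - Tr (W\<^sup>T M W)\<close>, so minimising it is maximising
  the compressed trace. By Ky Fan's principle that maximum is the sum of the \<open>k\<close> largest
  eigenvalues. The residual depends on \<open>W\<close> only through the projection \<open>W W\<^sup>T\<close>, hence only on
  the column space of \<open>W\<close>, so every basis of a top eigenspace attains it.\<close>

text \<open>The principle needs the spectral theorem in a form that controls the order of the
  eigenvectors. By definition \<open>eigenvalues_desc M\<close> is merely a sorted list of real
  roots of the characteristic polynomial, so two facts have to be supplied: the polynomial splits
  over the reals, which gives the list its full length, and some orthogonal matrix diagonalises
  \<open>M\<close> with its columns in the order of that list. Keeping the first \<open>k\<close> of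
  these columns then produces a top eigenspace. Nonnegativity of the eigenvalues is read off the
  residual itself: in codimension one a top eigenspace leaves exactly the smallest eigenvalue as
  residual, and a residual is a sum of nonnegative terms.\<close>

section \<open>Spectral theorem for real symmetric matrices\<close>

text \<open>Over the complex numbers the polynomial splits, so it suffices that each root a is real.
  If v is an eigenvector for a, then its conjugate is one for cnj a, and moving the symmetric matrix
  across the product of the two gives cnj a * s = a * s with s nonzero.\<close>

lemma char_poly_splits_of_real_symmetric:
  fixes M :: "real mat"
  assumes M: "M \<in> carrier_mat n n" and sym: "transpose_mat M = M"
  shows "\<exists>es. char_poly M = (\<Prod>e\<leftarrow>es. [:- e, 1:])"
proof -
  interpret h: map_poly_inj_comm_ring_hom complex_of_real ..
  let ?C = "map_mat complex_of_real M"
  have C: "?C \<in> carrier_mat n n" using M by simp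
  obtain as where as: "char_poly ?C = (\<Prod>a\<leftarrow>as. [:- a, 1:])"
    using char_poly_factorized[OF C] by blast
  have real: "a \<in> \<real>" if "a \<in> set as" for a
  proof -
    have "poly (char_poly ?C) a = 0"
      unfolding as poly_prod_list prod_list_zero_iff using that by (auto simp: image_iff)
    then obtain v where v: "v \<in> carrier_vec n" "v \<noteq> 0\<^sub>v n" "?C *\<^sub>v v = a \<cdot>\<^sub>v v"
      using eigenvalue_root_char_poly[OF C] C unfolding eigenvalue_def eigenvector_def by auto
    \<comment> \<open>The scalar product is bilinear, so the conjugation is written out;
      \<open>?s\<close> is then the squared length of \<open>v\<close>.\<close>
    let ?s = "conjugate v \<bullet> v"
    have s: "?s \<noteq> 0"
      using v conjugate_square_eq_0_vec[OF v(1)] by (simp add: comm_scalar_prod[of v n "conjugate v"])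
    have Cv: "?C *\<^sub>v conjugate v = cnj a \<cdot>\<^sub>v conjugate v"
    proof -
      have "?C *\<^sub>v conjugate v = conjugate (?C *\<^sub>v v)"
        using M v(1) by (intro eq_vecI) (auto simp: scalar_prod_def)
      also have "\<dots> = cnj a \<cdot>\<^sub>v conjugate v" unfolding v(3) by (intro eq_vecI) auto
      finally show ?thesis .
    qed
    have Ct: "transpose_mat ?C = ?C" using sym M by (metis map_mat_transpose)
    have "cnj a * ?s = (transpose_mat ?C *\<^sub>v conjugate v) \<bullet> v"
      using v unfolding Ct Cv by simp
    also have "\<dots> = conjugate v \<bullet> (?C *\<^sub>v v)"
      by (rule transpose_vec_mult_scalar[OF C]) (use v in auto)
    also have "\<dots> = a * ?s" using v by simp
    finally show ?thesis using s by (simp add: Reals_cnj_iff)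
  qed
  \<comment> \<open>The factorisation descends to the reals because the embedding of coefficients is
    an injective ring homomorphism.\<close>
  have "map_poly complex_of_real (char_poly M) = char_poly ?C"
    by (rule of_real_hom.char_poly_hom[OF M, symmetric])
  also have "\<dots> = (\<Prod>a\<leftarrow>as. [:- of_real (Re a), 1:])" unfolding as
    by (intro arg_cong[where f = prod_list] map_cong) (use real in \<open>auto simp: of_real_Re\<close>)
  also have "\<dots> = map_poly of_real (\<Prod>e\<leftarrow>map Re as. [:- e, 1:])"
    by (simp add: h.hom_prod_list o_def)
  finally show ?thesis by (intro exI[of _ "map Re as"]) simp
qed

text \<open>The witness is the Householder reflection swapping \<open>v\<close> and the first unit vector; if the two
  coincide, then \<open>s = 0\<close> and \<open>\<beta> = 2 / 0 = 0\<close> gives the identity.\<close>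

lemma orthogonal_mat_with_first_col:
  fixes v :: "real vec"
  assumes v: "v \<in> carrier_vec (Suc n)" and unit: "v \<bullet> v = 1"
  shows "\<exists>H\<in>carrier_mat (Suc n) (Suc n). transpose_mat H * H = 1\<^sub>m (Suc n) \<and> col H 0 = v"
proof -
  define w where "w = (\<lambda>i. v $ i - (if i = 0 then 1 else 0))"
  define s where "s = (\<Sum>i<Suc n. w i * w i)"
  define \<beta> where "\<beta> = 2 / s"
  define H where "H = mat (Suc n) (Suc n) (\<lambda>(i, j). (if i = j then 1 else 0) - \<beta> * w i * w j)"
  \<comment> \<open>With w = v - e_0 and v of length 1, the squared length of w is 2 - 2 v_0 = -2
    w_0. This makes \<beta> w_i w_0 = -w_i, so that column 0 of the reflection is e_0 + w =
    v.\<close>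
  have "(\<Sum>i<Suc n. w i * w i)
      = (\<Sum>i<Suc n. v $ i * v $ i) - 2 * (\<Sum>i<Suc n. if i = 0 then v $ i else 0)
        + (\<Sum>i<Suc n. if i = 0 then 1 else 0)"
    unfolding sum_distrib_left sum_subtractf[symmetric] sum.distrib[symmetric]
    by (intro sum.cong) (auto simp: w_def algebra_simps)
  moreover have "(\<Sum>i<Suc n. v $ i * v $ i) = 1"
    using v unit by (simp add: scalar_prod_def atLeast0LessThan)
  ultimately have s: "s = - 2 * w 0"
    unfolding s_def by (simp add: w_def sum.delta del: sum.lessThan_Suc)
  \<comment> \<open>In the product of the reflection with its transpose, the quadratic term
    \<beta>^2 s w_i w_j cancels the two cross terms \<beta> w_i w_j by this identity, which also
    holds for s = 0.\<close>
  have \<beta>s: "\<beta> * \<beta> * s = 2 * \<beta>" by (simp add: \<beta>_def)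
  have w0: "w i = 0" if "s = 0" "i < Suc n" for i
  proof -
    have "\<forall>i\<in>{..<Suc n}. w i * w i = 0"
      using that(1) unfolding s_def by (subst (asm) sum_nonneg_eq_0_iff) auto
    then show ?thesis using that(2) by auto
  qed
  have H: "H \<in> carrier_mat (Suc n) (Suc n)" by (simp add: H_def)
  have "transpose_mat H * H = 1\<^sub>m (Suc n)"
  proof (rule eq_matI)
    fix i j assume "i < dim_row (1\<^sub>m (Suc n) :: real mat)" "j < dim_col (1\<^sub>m (Suc n) :: real mat)"
    then have ij: "i < Suc n" "j < Suc n" by auto
    have "(transpose_mat H * H) $$ (i, j) = (\<Sum>l<Suc n. ((if l = i then 1 else 0) - \<beta> * w l * w i)
       * ((if l = j then 1 else 0) - \<beta> * w l * w j))"
      using ij by (simp add: H_def scalar_prod_def atLeast0LessThan del: sum.lessThan_Suc)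
    also have "\<dots> = (\<Sum>l<Suc n. (if l = i then (if i = j then 1 else 0) else 0))
       - (\<Sum>l<Suc n. if l = i then \<beta> * w i * w j else 0)
       - (\<Sum>l<Suc n. if l = j then \<beta> * w i * w j else 0)
       + (\<Sum>l<Suc n. \<beta> * \<beta> * w i * w j * (w l * w l))"
      unfolding sum_subtractf[symmetric] sum.distrib[symmetric]
      by (intro sum.cong) (auto simp: algebra_simps)
    also have "\<dots> = (if i = j then 1 else 0) - 2 * \<beta> * w i * w j + \<beta> * \<beta> * s * (w i * w j)"
      using ij by (simp add: sum.delta sum_distrib_left[symmetric] s_def[symmetric] del: sum.lessThan_Suc)
    also have "\<dots> = (1\<^sub>m (Suc n)) $$ (i, j)" unfolding \<beta>s using ij by simp
    finally show "(transpose_mat H * H) $$ (i, j) = (1\<^sub>m (Suc n)) $$ (i, j)" .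
  qed (auto simp: H_def)
  moreover have "col H 0 = v"
  proof (rule eq_vecI)
    fix i assume "i < dim_vec v"
    then have i: "i < Suc n" using v by simp
    have "\<beta> * w i * w 0 = - w i"
    proof (cases "s = 0")
      case False
      then show ?thesis unfolding \<beta>_def s by (simp add: field_simps)
    qed (use w0[OF _ i] in simp)
    then show "col H 0 $ i = v $ i" using i by (simp add: H_def w_def)
  qed (use v H in auto)
  ultimately show ?thesis using H by blast
qed

text \<open>Deflation, by induction on the list of roots: a unit eigenvector for the head
  \<open>e\<close> becomes the first column of an orthogonal \<open>H\<close>, and H^T M H splits
  into the block \<open>e\<close> and a smaller symmetric matrix whose characteristic polynomial is
  the remaining product. The list may come in any order and column i of \<open>U\<close> belongs to
  \<open>es ! i\<close>, so the decreasing order can be prescribed later.\<close>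

lemma spectral_decomposition_real_symmetric:
  fixes M :: "real mat"
  assumes M: "M \<in> carrier_mat n n" and sym: "transpose_mat M = M"
    and es: "char_poly M = (\<Prod>e\<leftarrow>es. [:- e, 1:])"
  shows "\<exists>U\<in>carrier_mat n n. transpose_mat U * U = 1\<^sub>m n \<and> M * U = U * mat_diag n ((!) es)"
  using assms
proof (induction es arbitrary: n M)
  case Nil
  then have "n = 0" using degree_monic_char_poly[of M n] by simp
  then show ?case using Nil by (intro bexI[of _ "1\<^sub>m 0"]) (auto intro!: eq_matI simp: mat_diag_def)
next
  case (Cons e es)
  have "degree (char_poly M) = n" using degree_monic_char_poly[OF Cons.prems(1)] by simp
  moreover have "degree (char_poly M) = Suc (length es)"
    unfolding Cons.prems(3) by (subst degree_linear_factors) simp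
  ultimately obtain m where n: "n = Suc m" by auto
  note M = Cons.prems(1)[unfolded n]
  have "poly (char_poly M) e = 0" unfolding Cons.prems(3) by simp
  then obtain w where w: "w \<in> carrier_vec (Suc m)" "w \<noteq> 0\<^sub>v (Suc m)" "M *\<^sub>v w = e \<cdot>\<^sub>v w"
    using eigenvalue_root_char_poly[OF M] M unfolding eigenvalue_def eigenvector_def by auto
  have ww: "w \<bullet> w > 0" using conjugate_square_greater_0_vec[OF w(1)] w(2) 
    by (simp add: conjugate_vec_def)
  define v where "v = (1 / sqrt (w \<bullet> w)) \<cdot>\<^sub>v w"
  have v: "v \<in> carrier_vec (Suc m)" using w by (simp add: v_def)
  have "v \<bullet> v = 1" using ww w(1) by (simp add: v_def field_simps)
  then obtain H where H: "H \<in> carrier_mat (Suc m) (Suc m)" "transpose_mat H * H = 1\<^sub>m (Suc m)" "col H 0 = v"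
    using orthogonal_mat_with_first_col[OF v] by blast
  have Mv: "M *\<^sub>v v = e \<cdot>\<^sub>v v" using w M
    by (simp add: v_def mult_mat_vec smult_smult_assoc mult.commute)
  let ?N = "Suc m"
  note assoc = assoc_mult_mat[of _ ?N ?N _ ?N _ ?N]
  let ?Ht = "transpose_mat H"
  have Ht: "?Ht \<in> carrier_mat ?N ?N" using H by simp
  have HHt: "H * ?Ht = 1\<^sub>m ?N" by (rule mat_mult_left_right_inverse[OF Ht H(1) H(2)])
  have cancel: "H * (?Ht * X) = X" "?Ht * (H * X) = X" if "X \<in> carrier_mat ?N ?N" for X
    using that H Ht HHt assoc[of H ?Ht X] assoc[of ?Ht H X] by simp_all
  define B where "B = ?Ht * (M * H)"
  have B: "B \<in> carrier_mat ?N ?N" using H M by (simp add: B_def)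
  have HB: "H * B = M * H" using H M by (simp add: B_def cancel)
  have MB: "M = H * B * ?Ht" unfolding HB using H M Ht HHt by (simp add: assoc)
  have "transpose_mat B = B"
    using H M Ht Cons.prems(2) by (simp add: B_def transpose_mult[of _ ?N ?N _ ?N] assoc)
  then have sym: "B $$ (i, j) = B $$ (j, i)" if "i < ?N" "j < ?N" for i j
    using that B by (metis carrier_matD index_transpose_mat(1))
  let ?u = "unit_vec ?N 0 :: real vec"
  have Hu: "H *\<^sub>v ?u = v" using H by (intro eq_vecI) auto
  have "?Ht *\<^sub>v v = (?Ht * H) *\<^sub>v ?u"
    unfolding Hu[symmetric] using H Ht by (intro assoc_mult_mat_vec[symmetric]) auto
  then have Htv: "?Ht *\<^sub>v v = ?u" unfolding H(2) by simp
  have "B *\<^sub>v ?u = ?Ht *\<^sub>v (M *\<^sub>v (H *\<^sub>v ?u))"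
    using H M Ht by (simp add: B_def assoc_mult_mat_vec[of _ ?N ?N _ ?N])
  also have "\<dots> = e \<cdot>\<^sub>v ?u"
    unfolding Hu Mv using Ht v by (simp add: mult_mat_vec Htv)
  finally have Bu: "B *\<^sub>v ?u = e \<cdot>\<^sub>v ?u" .
  have col: "B $$ (i, 0) = (if i = 0 then e else 0)" if "i < ?N" for i
  proof -
    have "B $$ (i, 0) = (B *\<^sub>v ?u) $ i" using that B by simp
    then show ?thesis unfolding Bu using that by simp
  qed
  define B' where "B' = mat m m (\<lambda>(i, j). B $$ (Suc i, Suc j))"
  let ?e = "mat 1 1 (\<lambda>_. e)"
  have B': "B' \<in> carrier_mat m m" by (simp add: B'_def)
  \<comment> \<open>The first column of \<open>B\<close> is e times the first unit vector because
    that vector is an eigenvector of \<open>B\<close>; by symmetry the first row vanishes off the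
    diagonal as well.\<close>
  have Bblock: "B = four_block_mat ?e (0\<^sub>m 1 m) (0\<^sub>m m 1) B'"
    using B sym[of 0] by (intro eq_matI) (auto simp: B'_def col)
  have "similar_mat M B"
    unfolding similar_mat_def using H M Ht HHt MB B by (blast intro: similar_mat_witI)
  then have "char_poly M = char_poly B" by (rule char_poly_similar)
  also have "\<dots> = char_poly ?e * char_poly B'"
    unfolding Bblock by (rule char_poly_four_block_zeros_col[OF _ _ B']) auto
  finally have "char_poly M = char_poly ?e * char_poly B'" .
  moreover have "char_poly ?e = [:- e, 1:]"
    by (simp add: char_poly_def char_poly_matrix_def det_single)
  \<comment> \<open>Cancelling a single linear factor removes one copy of \<open>e\<close>, so
    repeated eigenvalues stay in the list for the smaller block.\<close>
  ultimately have "[:- e, 1:] * char_poly B' = [:- e, 1:] * (\<Prod>e\<leftarrow>es. [:- e, 1:])"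
    unfolding Cons.prems(3) by simp
  then have "char_poly B' = (\<Prod>e\<leftarrow>es. [:- e, 1:])"
    by (subst (asm) mult_cancel_left) auto
  moreover have "transpose_mat B' = B'" using sym by (intro eq_matI) (auto simp: B'_def)
  ultimately obtain U' where U': "U' \<in> carrier_mat m m" "transpose_mat U' * U' = 1\<^sub>m m"
    "B' * U' = U' * mat_diag m ((!) es)" using Cons.IH[OF B'] by blast
  \<comment> \<open>\<open>F\<close> leaves the first coordinate alone and diagonalises the smaller
    block; \<open>H * F\<close> is the matrix sought.\<close>
  define F where "F = four_block_mat (1\<^sub>m 1) (0\<^sub>m 1 m) (0\<^sub>m m 1) U'"
  have F: "F \<in> carrier_mat ?N ?N" using four_block_carrier_mat[OF _ U'(1), of "1\<^sub>m 1" 1 1] by (simp add: F_def)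
  have "transpose_mat F * F = 1\<^sub>m ?N"
    unfolding F_def using U'
    by (simp add: transpose_four_block_mat[of _ 1 1 _ m _ m] mult_four_block_mat[of _ 1 1 _ m _ m _ _ 1 _ m])
  moreover have "B * F = F * mat_diag ?N ((!) (e # es))"
  proof -
    have "mat_diag ?N ((!) (e # es)) = four_block_mat ?e (0\<^sub>m 1 m) (0\<^sub>m m 1) (mat_diag m ((!) es))"
      by (intro eq_matI) (auto simp: mat_diag_def nth_Cons')
    then show ?thesis unfolding F_def Bblock using U' B'
      by (simp add: left_mult_zero_mat[OF mat_diag_dim] mult_four_block_mat[of _ 1 1 _ m _ m _ _ 1 _ m])
  qed
  moreover have "transpose_mat (H * F) * (H * F) = transpose_mat F * F"
    using H F Ht by (simp add: transpose_mult[of _ ?N ?N _ ?N] assoc cancel)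
  moreover have "M * (H * F) = H * (B * F)"
  proof -
    have "M * (H * F) = H * B * F" unfolding HB using H F M by (simp add: assoc)
    then show ?thesis using H F B by (simp add: assoc)
  qed
  ultimately show ?case unfolding n using H F
    by (intro bexI[of _ "H * F"]) (simp_all add: assoc)
qed

lemma proots_linear_factors: "proots (\<Prod>e\<leftarrow>es. [:- e, 1:]) = mset (es :: 'a :: idom list)"
proof (induction es)
  case (Cons e es)
  have "(\<Prod>e\<leftarrow>es. [:- e, 1:]) \<noteq> 0" by (auto simp: prod_list_zero_iff)
  then have "proots ([:- e, 1:] * (\<Prod>e\<leftarrow>es. [:- e, 1:])) = {#e#} + mset es"
    by (subst proots_mult) (auto simp: Cons.IH)
  then show ?case by simp
qed simp

text \<open>Since the characteristic polynomial splits over the reals, its multiset of real roots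
  holds all n roots with multiplicity, and sorting it only permutes the linear factors.\<close>

lemma eigenvalues_desc_real_symmetric:
  assumes M: "M \<in> carrier_mat n n" and sym: "transpose_mat M = M"
  shows "char_poly M = (\<Prod>e\<leftarrow>eigenvalues_desc M. [:- e, 1:])" (is ?poly)
    and "length (eigenvalues_desc M) = n" (is ?length)
    and "sorted_wrt (\<ge>) (eigenvalues_desc M)" (is ?sorted)
proof -
  obtain es where es: "char_poly M = (\<Prod>e\<leftarrow>es. [:- e, 1:])"
    using char_poly_splits_of_real_symmetric[OF assms] by blast
  have m: "mset (eigenvalues_desc M) = mset es"
    unfolding eigenvalues_desc_def es proots_linear_factors by simp
  then have "mset (map (\<lambda>e. [:- e, 1:]) (eigenvalues_desc M)) = mset (map (\<lambda>e. [:- e, 1:]) es)"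
    by simp
  then show ?poly unfolding es by (metis prod_mset_prod_list)
  then have "degree (char_poly M) = length (eigenvalues_desc M)"
    by (simp add: degree_linear_factors)
  then show ?length using degree_monic_char_poly[OF M] by simp
  show ?sorted
    unfolding eigenvalues_desc_def sorted_wrt_rev by simp
qed

section \<open>Traces, the Frobenius norm and the residual\<close>

lemma mat_trace_mult_comm:
  assumes "A \<in> carrier_mat m n" "B \<in> carrier_mat n m"
  shows "mat_trace (A * B) = mat_trace (B * A)"
proof -
  have "mat_trace (A * B) = (\<Sum>i<m. \<Sum>j<n. A $$ (i, j) * B $$ (j, i))"
    using assms by (simp add: mat_trace_def scalar_prod_def atLeast0LessThan)
  also have "\<dots> = (\<Sum>j<n. \<Sum>i<m. B $$ (j, i) * A $$ (i, j))"
    by (subst sum.swap) (simp add: mult.commute)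
  also have "\<dots> = mat_trace (B * A)"
    using assms by (simp add: mat_trace_def scalar_prod_def atLeast0LessThan)
  finally show ?thesis .
qed

lemma mat_trace_add:
  "A \<in> carrier_mat n n \<Longrightarrow> B \<in> carrier_mat n n \<Longrightarrow> mat_trace (A + B) = mat_trace A + mat_trace B"
  by (simp add: mat_trace_def sum.distrib)

lemma mat_trace_minus:
  "A \<in> carrier_mat n n \<Longrightarrow> B \<in> carrier_mat n n \<Longrightarrow> mat_trace (A - B) = mat_trace A - mat_trace B"
  by (simp add: mat_trace_def sum_subtractf)

lemma mat_trace_smult: "A \<in> carrier_mat n n \<Longrightarrow> mat_trace (a \<cdot>\<^sub>m A) = a * mat_trace A"
  by (simp add: mat_trace_def sum_distrib_left)

lemma mat_trace_mat_diag: "mat_trace (mat_diag n f) = (\<Sum>i<n. f i)"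
  by (simp add: mat_trace_def mat_diag_def)

lemma frobenius_norm_square: "(frobenius_norm A)\<^sup>2 = mat_trace (transpose_mat A * A)"
proof -
  have "(frobenius_norm A)\<^sup>2 = (\<Sum>i<dim_row A. \<Sum>j<dim_col A. (A $$ (i, j))\<^sup>2)"
    unfolding frobenius_norm_def by (simp add: sum_nonneg)
  also have "\<dots> = mat_trace (transpose_mat A * A)"
    by (subst sum.swap) (simp add: mat_trace_def scalar_prod_def atLeast0LessThan power2_eq_square)
  finally show ?thesis .
qed

lemma orthonormal_cols_iff:
  assumes "W \<in> carrier_mat D k"
  shows "orthonormal_list (cols W) \<longleftrightarrow> W \<in> stiefel D k"
proof -
  have "transpose_mat W * W = 1\<^sub>m k \<longleftrightarrow> (\<forall>i<k. \<forall>j<k. col W i \<bullet> col W j = (if i = j then 1 else 0))"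
    using assms by (subst mat_eq_iff) auto
  then show ?thesis using assms by (auto simp: orthonormal_list_def stiefel_def)
qed

lemma stiefel_projection_idem:
  assumes "W \<in> stiefel D k"
  shows "W * transpose_mat W * (W * transpose_mat W) = W * transpose_mat W"
proof -
  have W: "W \<in> carrier_mat D k" "transpose_mat W * W = 1\<^sub>m k"
    using assms by (auto simp: stiefel_def)
  have "W * transpose_mat W * (W * transpose_mat W) = W * (transpose_mat W * (W * transpose_mat W))"
    using W by (intro assoc_mult_mat[of _ D k _ D]) auto
  also have "transpose_mat W * (W * transpose_mat W) = transpose_mat W * W * transpose_mat W"
    using W by (intro assoc_mult_mat[symmetric, of _ k D _ k]) auto
  finally show ?thesis using W by simp
qed

text \<open>The matrix Q = I - W W^T is symmetric and idempotent, so the squared norm of Q B is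
  Tr(B^T Q B). Rotating factors under the trace gives Tr(Q B B^T), and rotating once more turns the
  subtracted part into the compression by \<open>W\<close>.\<close>

lemma frobenius_norm_proj_perp:
  assumes W: "W \<in> stiefel D k" and B: "B \<in> carrier_mat D d"
  shows "(frobenius_norm (proj_perp W * B))\<^sup>2 =
    mat_trace (B * transpose_mat B) - mat_trace (transpose_mat W * (B * transpose_mat B) * W)"
proof -
  have W: "W \<in> carrier_mat D k" "transpose_mat W * W = 1\<^sub>m k"
    using assms(1) by (auto simp: stiefel_def)
  let ?P = "W * transpose_mat W" and ?Q = "proj_perp W" and ?S = "B * transpose_mat B"
  have P: "?P \<in> carrier_mat D D" using W by simp
  have S: "?S \<in> carrier_mat D D" using B by simp
  have Q: "?Q \<in> carrier_mat D D" "?Q = 1\<^sub>m D - ?P" using W by (auto simp: proj_perp_def)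
  have Pt: "transpose_mat ?P = ?P" using W by (simp add: transpose_mult[of _ D k _ D])
  have Qt: "transpose_mat ?Q = ?Q" unfolding Q(2) using P Pt
    by (subst transpose_minus[of _ D D]) auto
  have PP: "?P * ?P = ?P" by (rule stiefel_projection_idem[OF assms(1)])
  have "?Q * ?P = 1\<^sub>m D * ?P - ?P * ?P"
    unfolding Q(2) using P by (intro minus_mult_distrib_mat[of _ D D]) auto
  then have QP: "?Q * ?P = 0\<^sub>m D D" unfolding PP left_mult_one_mat[OF P] using P by auto
  have "?Q * (1\<^sub>m D - ?P) = ?Q * 1\<^sub>m D - ?Q * ?P"
    using P Q(1) by (intro mult_minus_distrib_mat[of _ D D _ D]) auto
  then have QQ: "?Q * ?Q = ?Q"
    unfolding QP Q(2)[symmetric] right_mult_one_mat[OF Q(1)] using Q(1)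
    by (auto intro!: eq_matI)
  have "transpose_mat (?Q * B) * (?Q * B) = transpose_mat B * ?Q * (?Q * B)"
    by (simp only: transpose_mult[OF Q(1) B] Qt)
  also have "\<dots> = transpose_mat B * (?Q * (?Q * B))"
    using Q(1) B by (intro assoc_mult_mat[of _ d D _ D]) auto
  also have "?Q * (?Q * B) = ?Q * B"
    using Q(1) B by (subst assoc_mult_mat[of _ D D _ D, symmetric]) (auto simp only: QQ)
  finally have "(frobenius_norm (?Q * B))\<^sup>2 = mat_trace (transpose_mat B * (?Q * B))"
    unfolding frobenius_norm_square by simp
  also have "\<dots> = mat_trace (?Q * B * transpose_mat B)"
    using Q(1) B by (intro mat_trace_mult_comm[of _ d D]) auto
  also have "?Q * B * transpose_mat B = ?S - ?P * ?S"
  proof -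
    have "?Q * B * transpose_mat B = ?Q * ?S"
      using Q(1) B by (intro assoc_mult_mat[of _ D D _ d _ D]) auto
    also have "\<dots> = 1\<^sub>m D * ?S - ?P * ?S"
      unfolding Q(2) using P S by (intro minus_mult_distrib_mat[of _ D D _ _ D]) auto
    finally show ?thesis unfolding left_mult_one_mat[OF S] .
  qed
  also have "mat_trace \<dots> = mat_trace ?S - mat_trace (W * (transpose_mat W * ?S))"
    using P S W by (simp add: mat_trace_minus[of _ D] assoc_mult_mat[of _ D k _ D _ D])
  also have "mat_trace (W * (transpose_mat W * ?S)) = mat_trace (transpose_mat W * ?S * W)"
    using W S by (intro mat_trace_mult_comm[of _ D k]) auto
  finally show ?thesis .
qed

lemma residual_stiefel:
  assumes W: "W \<in> stiefel D k" and A: "\<forall>i\<in>{1, 2}. A i \<in> carrier_mat D (d i)"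
    and M: "M = mix_matrix \<omega> c A"
  shows "residual \<omega> c A W = mat_trace M - mat_trace (transpose_mat W * M * W)"
proof -
  have W': "W \<in> carrier_mat D k" using W by (simp add: stiefel_def)
  let ?S = "\<lambda>i. A i * transpose_mat (A i)"
  have S: "?S 1 \<in> carrier_mat D D" "?S 2 \<in> carrier_mat D D"
    using A by (auto intro!: mult_carrier_mat)
  have eq: "transpose_mat W * M * W = (\<omega> 1 * c 1) \<cdot>\<^sub>m (transpose_mat W * ?S 1 * W) +
      (\<omega> 2 * c 2) \<cdot>\<^sub>m (transpose_mat W * ?S 2 * W)"
    unfolding M mix_matrix_def using S W'
    by (simp add: mult_add_distrib_mat[of _ k D _ D] add_mult_distrib_mat[of _ k D _ _ k]
        mult_smult_distrib[of _ k D _ D] mult_smult_assoc_mat[of _ k D _ k])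
  have car: "transpose_mat W * ?S 1 * W \<in> carrier_mat k k" "transpose_mat W * ?S 2 * W \<in> carrier_mat k k"
    using W' S by (auto intro!: mult_carrier_mat[of _ k D])
  have fr: "(frobenius_norm (proj_perp W * A i))\<^sup>2 =
      mat_trace (?S i) - mat_trace (transpose_mat W * ?S i * W)" if "i \<in> {1, 2}" for i
    using A that by (intro frobenius_norm_proj_perp[OF W, of _ "d i"]) auto
  have "mat_trace (transpose_mat W * M * W) =
      \<omega> 1 * c 1 * mat_trace (transpose_mat W * ?S 1 * W) + \<omega> 2 * c 2 * mat_trace (transpose_mat W * ?S 2 * W)"
    unfolding eq using car by (simp add: mat_trace_add[of _ k] mat_trace_smult[of _ k])
  moreover have "mat_trace M = \<omega> 1 * c 1 * mat_trace (?S 1) + \<omega> 2 * c 2 * mat_trace (?S 2)"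
    unfolding M mix_matrix_def using S by (simp add: mat_trace_add[of _ D] mat_trace_smult[of _ D])
  ultimately show ?thesis
    unfolding residual_def by (simp add: fr right_diff_distrib)
qed

section \<open>Ky Fan's maximum principle\<close>

text \<open>A total weight k with at most 1 per index is best spent on the k largest values.
  Subtracting the k-th largest value t leaves nonnegative terms below index k, where weight 1 is
  best, and nonpositive terms beyond, where weight 0 is best; the subtracted amount is k t on both
  sides.\<close>

lemma weighted_sum_le_sum_top:
  fixes f a :: "nat \<Rightarrow> real"
  assumes f: "\<And>i j. i \<le> j \<Longrightarrow> j < n \<Longrightarrow> f j \<le> f i" and k: "k \<le> n"
    and a: "\<And>i. i < n \<Longrightarrow> 0 \<le> a i" "\<And>i. i < n \<Longrightarrow> a i \<le> 1" and sum: "(\<Sum>i<n. a i) = real k"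
  shows "(\<Sum>i<n. f i * a i) \<le> (\<Sum>i<k. f i)"
proof (cases "k = 0")
  case True
  then have "\<forall>i\<in>{..<n}. a i = 0"
    using sum sum_nonneg_eq_0_iff[of "{..<n}" a] a(1) by auto
  then show ?thesis using True by simp
next
  case False
  let ?t = "f (k - 1)"
  have "(\<Sum>i<n. (f i - ?t) * a i) \<le> (\<Sum>i<n. if i < k then f i - ?t else 0)"
  proof (rule sum_mono)
    fix i assume "i \<in> {..<n}"
    then have i: "i < n" by simp
    show "(f i - ?t) * a i \<le> (if i < k then f i - ?t else 0)"
    proof (cases "i < k")
      case True
      then have "?t \<le> f i" using k False by (intro f) auto
      then show ?thesis using True a[OF i] by (simp add: mult_left_le)
    next
      case i': False
      then have "f i \<le> ?t" using i False by (intro f) auto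
      then show ?thesis using i' a[OF i] by (simp add: mult_nonpos_nonneg)
    qed
  qed
  also have "\<dots> = (\<Sum>i<k. f i - ?t)"
    using k by (subst sum.inter_filter[symmetric]) (auto intro!: sum.cong)
  finally show ?thesis
    using sum sum_distrib_right[of a "{..<n}" ?t]
    by (simp add: algebra_simps sum_subtractf)
qed

text \<open>The sum is the diagonal entry P_ii of P = Z Z^T. As P is symmetric and idempotent, P_ii
  is the sum over l of the squares of P_il, hence at least the square of P_ii, which forces P_ii to
  be at most 1.\<close>

lemma stiefel_row_norm_le_1:
  assumes Z: "Z \<in> stiefel D k" and i: "i < D"
  shows "(\<Sum>j<k. (Z $$ (i, j))\<^sup>2) \<le> 1"
proof -
  have Z': "Z \<in> carrier_mat D k" "transpose_mat Z * Z = 1\<^sub>m k"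
    using Z by (auto simp: stiefel_def)
  define P where "P = Z * transpose_mat Z"
  have P: "P \<in> carrier_mat D D" using Z' by (simp add: P_def)
  have PP: "P * P = P" unfolding P_def by (rule stiefel_projection_idem[OF Z])
  have sym: "P $$ (l, i) = P $$ (i, l)" if "l < D" for l
    using Z' i that by (simp add: P_def comm_scalar_prod[of _ k])
  have Pii: "P $$ (i, i) = (\<Sum>j<k. (Z $$ (i, j))\<^sup>2)"
    using Z' i by (simp add: P_def scalar_prod_def atLeast0LessThan power2_eq_square)
  have "(P $$ (i, i))\<^sup>2 \<le> (\<Sum>l<D. (P $$ (i, l))\<^sup>2)"
    using i by (intro member_le_sum) auto
  also have "\<dots> = (P * P) $$ (i, i)"
    using P i by (simp add: scalar_prod_def atLeast0LessThan sym power2_eq_square)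
  finally have "P $$ (i, i) * P $$ (i, i) \<le> 1 * P $$ (i, i)" by (simp add: PP power2_eq_square)
  then have "P $$ (i, i) \<le> 1"
    using mult_strict_right_mono[of 1 "P $$ (i, i)" "P $$ (i, i)"] by linarith
  then show ?thesis by (simp add: Pii)
qed

text \<open>Here V^T M V collapses to the diagonal matrix itself. With \<open>k\<close> eigenvectors
  this shows that the Ky Fan bound is reached; with all \<open>D\<close> of them it yields the trace
  of \<open>M\<close>.\<close>

lemma mat_trace_eigenvector_compression:
  assumes V: "V \<in> stiefel D k" and M: "M \<in> carrier_mat D D" and eig: "M * V = V * mat_diag k f"
  shows "mat_trace (transpose_mat V * M * V) = (\<Sum>i<k. f i)"
proof -
  have V': "V \<in> carrier_mat D k" "transpose_mat V * V = 1\<^sub>m k"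
    using V by (auto simp: stiefel_def)
  have "transpose_mat V * M * V = transpose_mat V * (V * mat_diag k f)"
    using V' M by (simp add: assoc_mult_mat[of _ k D _ D _ k] eig)
  also have "\<dots> = transpose_mat V * V * mat_diag k f"
    using V' by (intro assoc_mult_mat[symmetric, of _ k D _ k _ k]) auto
  finally show ?thesis using V'(2) by (simp add: left_mult_one_mat[OF mat_diag_dim] mat_trace_mat_diag)
qed

text \<open>Ky Fan's maximum principle: in an eigenbasis \<open>U\<close> the trace becomes a sum of the
  eigenvalues weighted by the squared row norms of \<open>U\<^sup>T W\<close>, which lie in \<open>[0, 1]\<close> and add up
  to \<open>k\<close>.\<close>

lemma mat_trace_compression_le:
  assumes M: "M \<in> carrier_mat D D" "transpose_mat M = M" and k: "k \<le> D"
    and W: "W \<in> stiefel D k"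
  shows "mat_trace (transpose_mat W * M * W) \<le> (\<Sum>i<k. eigenvalues_desc M ! i)"
proof -
  let ?es = "eigenvalues_desc M"
  note es = eigenvalues_desc_real_symmetric[OF M]
  have W': "W \<in> carrier_mat D k" "transpose_mat W * W = 1\<^sub>m k"
    using W by (auto simp: stiefel_def)
  obtain U where U: "U \<in> carrier_mat D D" "transpose_mat U * U = 1\<^sub>m D"
    "M * U = U * mat_diag D ((!) ?es)"
    using spectral_decomposition_real_symmetric[OF M es(1)] by blast
  have UUt: "U * transpose_mat U = 1\<^sub>m D"
    using mat_mult_left_right_inverse[OF _ U(1,2)] U(1) by simp
  define Z where "Z = transpose_mat U * W"
  have Z: "Z \<in> carrier_mat D k" using U W' by (simp add: Z_def)
  have "U * Z = U * transpose_mat U * W" unfolding Z_def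
    using U W' by (intro assoc_mult_mat[symmetric, of _ D D _ D _ k]) auto
  then have UZ: "U * Z = W" using W' by (simp add: UUt)
  have "transpose_mat Z * Z = transpose_mat W * (U * Z)"
    unfolding Z_def using U W'
    by (simp add: transpose_mult[of _ D D _ k] assoc_mult_mat[of _ k D _ D _ k])
  then have ZZ: "transpose_mat Z * Z = 1\<^sub>m k" unfolding UZ using W' by simp
  then have Zst: "Z \<in> stiefel D k" using Z by (simp add: stiefel_def)
  have "transpose_mat W * M * W = transpose_mat W * (M * U * Z)"
    using W' M(1) U(1) Z
    by (simp add: UZ assoc_mult_mat[of _ D D _ D _ k] assoc_mult_mat[of _ k D _ D _ k])
  also have "\<dots> = transpose_mat Z * (mat_diag D ((!) ?es) * Z)"
    unfolding U(3) Z_def using W' U(1) Z[unfolded Z_def]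
    by (simp add: transpose_mult[of _ D D _ k] assoc_mult_mat[of _ k D _ D _ k]
        assoc_mult_mat[of _ D D _ D _ k] mult_carrier_mat[OF mat_diag_dim])
  also have "mat_trace \<dots> = mat_trace (mat_diag D ((!) ?es) * Z * transpose_mat Z)"
    using Z by (intro mat_trace_mult_comm[of _ k D]) (auto intro!: mult_carrier_mat[OF mat_diag_dim])
  also have "\<dots> = (\<Sum>i<D. ?es ! i * (\<Sum>j<k. (Z $$ (i, j))\<^sup>2))"
    using Z by (simp add: mat_diag_mult_left[OF Z] mat_trace_def scalar_prod_def atLeast0LessThan
        sum_distrib_left power2_eq_square mult.assoc)
  also have "\<dots> \<le> (\<Sum>i<k. ?es ! i)"
  proof (rule weighted_sum_le_sum_top[OF _ k])
    show "?es ! j \<le> ?es ! i" if "i \<le> j" "j < D" for i j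
      using sorted_wrt_nth_less[OF es(3), of i j] that es(2) by (cases "i = j") auto
    have "(\<Sum>i<D. \<Sum>j<k. (Z $$ (i, j))\<^sup>2) = mat_trace (transpose_mat Z * Z)"
      using Z by (subst sum.swap)
        (simp add: mat_trace_def scalar_prod_def atLeast0LessThan power2_eq_square)
    then show "(\<Sum>i<D. \<Sum>j<k. (Z $$ (i, j))\<^sup>2) = real k"
      unfolding ZZ by (simp add: mat_trace_def)
  qed (use stiefel_row_norm_le_1[OF Zst] in \<open>auto intro: sum_nonneg\<close>)
  finally show ?thesis .
qed

section \<open>Projections and column spaces\<close>

lemma col_in_column_space:
  assumes B: "B \<in> carrier_mat D d" and j: "j < d"
  shows "col B j \<in> column_space B"
proof -
  have "B *\<^sub>v unit_vec d j = col B j" using B j by (intro eq_vecI) auto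
  then show ?thesis
    using B j by (subst vec_space.col_space_eq) auto
qed

text \<open>Every column of \<open>B\<close> has the form V x, and V V^T V x = V x because V^T V is
  the identity.\<close>

lemma stiefel_projection_fixes:
  assumes V: "V \<in> stiefel D k" and B: "B \<in> carrier_mat D d"
    and sub: "column_space B \<subseteq> column_space V"
  shows "V * transpose_mat V * B = B"
proof (rule mat_col_eqI)
  have V': "V \<in> carrier_mat D k" "transpose_mat V * V = 1\<^sub>m k"
    using V by (auto simp: stiefel_def)
  show "dim_row (V * transpose_mat V * B) = dim_row B" "dim_col (V * transpose_mat V * B) = dim_col B"
    using V' B by auto
  fix j assume "j < dim_col B"
  then have j: "j < d" using B by simp
  have "col B j \<in> column_space V" using col_in_column_space[OF B j] sub by blast
  then obtain x where x: "x \<in> carrier_vec k" "col B j = V *\<^sub>v x"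
    using V' by (subst (asm) vec_space.col_space_eq) auto
  have "col (V * transpose_mat V * B) j = V * transpose_mat V *\<^sub>v (V *\<^sub>v x)"
    unfolding x(2)[symmetric] using V'(1) by (intro col_mult2[OF _ B j]) auto
  also have "\<dots> = V *\<^sub>v (transpose_mat V * V *\<^sub>v x)"
    using V'(1) x(1) by (simp add: assoc_mult_mat_vec[of _ D k _ D] assoc_mult_mat_vec[of _ k D _ k])
  finally show "col (V * transpose_mat V * B) j = col B j" unfolding V'(2) using x by simp
qed

text \<open>Write P and Q for the two projections. Each fixes the columns of the other matrix, so Q
  P = P and P Q = Q; transposing the second equation gives Q P = Q, hence P = Q.\<close>

lemma proj_perp_cong_column_space:
  assumes V: "V \<in> stiefel D k" and W: "W \<in> stiefel D l" and eq: "column_space V = column_space W"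
  shows "proj_perp V = proj_perp W"
proof -
  have c: "V \<in> carrier_mat D k" "W \<in> carrier_mat D l" using V W by (auto simp: stiefel_def)
  let ?P = "V * transpose_mat V" and ?Q = "W * transpose_mat W"
  have t: "transpose_mat ?P = ?P" "transpose_mat ?Q = ?Q"
    using c by (auto simp: transpose_mult[of _ D k _ D] transpose_mult[of _ D l _ D])
  have "?Q * ?P = ?Q * V * transpose_mat V"
    using c by (intro assoc_mult_mat[symmetric, of _ D D _ k _ D]) auto
  then have QP: "?Q * ?P = ?P"
    using stiefel_projection_fixes[OF W c(1)] eq by simp
  have "?P * ?Q = ?P * W * transpose_mat W"
    using c by (intro assoc_mult_mat[symmetric, of _ D D _ l _ D]) auto
  then have "?P * ?Q = ?Q"
    using stiefel_projection_fixes[OF V c(2)] eq by simp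
  then have "transpose_mat (?P * ?Q) = ?Q" by (simp only: t)
  then have "?Q * ?P = ?Q"
    using c by (subst (asm) transpose_mult[of _ D D _ D]) (auto simp: t)
  then show ?thesis using QP c by (simp add: proj_perp_def)
qed

section \<open>Eigenvector matrices and top eigenspaces\<close>

lemma mat_trace_eq_sum_eigenvalues:
  assumes M: "M \<in> carrier_mat D D" "transpose_mat M = M"
  shows "mat_trace M = (\<Sum>i<D. eigenvalues_desc M ! i)"
proof -
  obtain U where U: "U \<in> carrier_mat D D" "transpose_mat U * U = 1\<^sub>m D"
    "M * U = U * mat_diag D ((!) (eigenvalues_desc M))"
    using spectral_decomposition_real_symmetric[OF M eigenvalues_desc_real_symmetric(1)[OF M]] by blast
  have UUt: "U * transpose_mat U = 1\<^sub>m D"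
    using mat_mult_left_right_inverse[OF _ U(1,2)] U(1) by simp
  have "U * (transpose_mat U * M) = U * transpose_mat U * M"
    using U(1) M(1) by (intro assoc_mult_mat[symmetric, of _ D D _ D _ D]) auto
  then have "U * (transpose_mat U * M) = M" using M(1) by (simp add: UUt)
  then have "mat_trace M = mat_trace (transpose_mat U * M * U)"
    using mat_trace_mult_comm[of U D D "transpose_mat U * M"] U(1) M(1) by simp
  then show ?thesis
    using mat_trace_eigenvector_compression[OF _ M(1) U(3)] U(1,2) by (simp add: stiefel_def)
qed

text \<open>Both sides are compared column by column. The columnwise form restricts at once to an
  initial segment of columns, which is how a full eigenbasis is truncated.\<close>

lemma mult_mat_diag_iff_eigenvectors:
  fixes M V :: "'a :: comm_ring_1 mat"
  assumes M: "M \<in> carrier_mat n n" and V: "V \<in> carrier_mat n k"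
  shows "M * V = V * mat_diag k f \<longleftrightarrow> (\<forall>j<k. M *\<^sub>v col V j = f j \<cdot>\<^sub>v col V j)"
proof -
  have "M * V = V * mat_diag k f \<longleftrightarrow> (\<forall>j<k. col (M * V) j = col (V * mat_diag k f) j)"
    (is "?L \<longleftrightarrow> ?R")
  proof
    assume ?R
    then show ?L using M V by (intro mat_col_eqI) (auto simp: mat_diag_def)
  qed simp
  moreover have "col (V * mat_diag k f) j = f j \<cdot>\<^sub>v col V j" if "j < k" for j
    using that V by (intro eq_vecI) (auto simp: mat_diag_mult_right[OF V] mult.commute)
  moreover have "col (M * V) j = M *\<^sub>v col V j" if "j < k" for j
    using that by (intro col_mult2[OF M V])
  ultimately show ?thesis by auto
qed

text \<open>The list of orthonormal eigenvectors is packed into the columns of one matrix, so that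
  matrix identities and trace computations apply to top eigenspaces.\<close>

lemma top_eigenspace_iff_stiefel:
  assumes M: "M \<in> carrier_mat D D"
  shows "top_eigenspace M k S \<longleftrightarrow>
    (\<exists>V\<in>stiefel D k. M * V = V * mat_diag k ((!) (eigenvalues_desc M)) \<and> S = column_space V)"
    (is "_ \<longleftrightarrow> ?R")
proof
  assume "top_eigenspace M k S"
  then obtain us where us: "length us = k" "set us \<subseteq> carrier_vec D" "orthonormal_list us"
    and ev: "\<forall>j\<in>{1..k}. eigenvector M (us ! (j - 1)) (nth_eigenvalue M j)"
    and S: "S = LinearCombinations.module.span class_ring (module_vec TYPE(real) D) (set us)"
    using M unfolding top_eigenspace_def by auto
  let ?V = "mat_of_cols D us"
  have V: "?V \<in> carrier_mat D k" and cols: "cols ?V = us" using us by auto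
  have "M *\<^sub>v col ?V j = eigenvalues_desc M ! j \<cdot>\<^sub>v col ?V j" if "j < k" for j
  proof -
    \<comment> \<open>\<open>nth_eigenvalue\<close> counts from 1 and lists from 0, so the
      hypothesis is used at \<open>Suc j\<close>.\<close>
    have "eigenvector M (us ! j) (eigenvalues_desc M ! j)"
      using ev[rule_format, of "Suc j"] that by (simp add: nth_eigenvalue_def)
    moreover have "col ?V j = us ! j" using that us by (auto intro!: col_mat_of_cols)
    ultimately show ?thesis by (simp add: eigenvector_def)
  qed
  then have "M * ?V = ?V * mat_diag k ((!) (eigenvalues_desc M))"
    by (simp add: mult_mat_diag_iff_eigenvectors[OF M V])
  moreover have "?V \<in> stiefel D k" using orthonormal_cols_iff[OF V] us(3) by (simp add: cols)
  moreover have "S = column_space ?V" unfolding S vec_space.col_space_def cols by simp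
  ultimately show ?R by blast
next
  assume ?R
  then obtain V where V: "V \<in> stiefel D k" "M * V = V * mat_diag k ((!) (eigenvalues_desc M))"
    and S: "S = column_space V" by blast
  have V': "V \<in> carrier_mat D k" using V(1) by (simp add: stiefel_def)
  have on: "orthonormal_list (cols V)" using orthonormal_cols_iff[OF V'] V(1) by simp
  have ev: "eigenvector M (cols V ! (j - 1)) (nth_eigenvalue M j)" if "j \<in> {1..k}" for j
  proof -
    have j: "j - 1 < k" using that by auto
    \<comment> \<open>An eigenvector must be nonzero, which the matrix equation does not say; unit
      length supplies it.\<close>
    have "col V (j - 1) \<bullet> col V (j - 1) = 1"
      using on j V' by (auto simp: orthonormal_list_def)
    then have "col V (j - 1) \<noteq> 0\<^sub>v D" using V' j by (auto simp: carrier_vecI)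
    moreover have "M *\<^sub>v col V (j - 1) = nth_eigenvalue M j \<cdot>\<^sub>v col V (j - 1)"
      using V(2) j unfolding mult_mat_diag_iff_eigenvectors[OF M V'] nth_eigenvalue_def by simp
    ultimately show ?thesis using V' M j by (auto simp: eigenvector_def)
  qed
  show "top_eigenspace M k S"
    unfolding top_eigenspace_def S using M V' on ev cols_dim[of V]
    by (intro exI[of _ "cols V"]) (auto simp: vec_space.col_space_def)
qed

text \<open>The spectral decomposition is applied to the decreasing list of eigenvalues, so the
  first \<open>k\<close> columns of \<open>U\<close> belong to the \<open>k\<close> largest
  ones.\<close>

lemma exists_top_eigenspace:
  assumes M: "M \<in> carrier_mat D D" "transpose_mat M = M" and k: "k \<le> D"
  shows "\<exists>W\<in>stiefel D k. top_eigenspace M k (column_space W)"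
proof -
  obtain U where U: "U \<in> carrier_mat D D" "transpose_mat U * U = 1\<^sub>m D"
    "M * U = U * mat_diag D ((!) (eigenvalues_desc M))"
    using spectral_decomposition_real_symmetric[OF M eigenvalues_desc_real_symmetric(1)[OF M]] by blast
  define W where "W = mat D k (\<lambda>(i, j). U $$ (i, j))"
  have W: "W \<in> carrier_mat D k" by (simp add: W_def)
  have col: "col W j = col U j" if "j < k" for j
    using that k U(1) by (intro eq_vecI) (auto simp: W_def)
  have "orthonormal_list (cols U)"
    using orthonormal_cols_iff[OF U(1)] U(1,2) by (simp add: stiefel_def)
  then have "orthonormal_list (cols W)"
    using W U(1) k by (simp add: orthonormal_list_def col)
  then have "W \<in> stiefel D k" by (simp add: orthonormal_cols_iff[OF W])
  moreover have "M * W = W * mat_diag k ((!) (eigenvalues_desc M))"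
    using U(3) k unfolding mult_mat_diag_iff_eigenvectors[OF M(1) W]
      mult_mat_diag_iff_eigenvectors[OF M(1) U(1)] by (simp add: col)
  ultimately show ?thesis by (auto simp: top_eigenspace_iff_stiefel[OF M(1)])
qed

section \<open>The minimum of the residual\<close>

lemma mix_matrix_symmetric:
  assumes "\<forall>i\<in>{1, 2}. A i \<in> carrier_mat D (d i)"
  shows "mix_matrix \<omega> c A \<in> carrier_mat D D"
    and "transpose_mat (mix_matrix \<omega> c A) = mix_matrix \<omega> c A"
proof -
  let ?S = "\<lambda>i. A i * transpose_mat (A i)"
  have A: "A 1 \<in> carrier_mat D (d 1)" "A 2 \<in> carrier_mat D (d 2)" using assms by auto
  then have S: "?S 1 \<in> carrier_mat D D" "?S 2 \<in> carrier_mat D D" by auto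
  show "mix_matrix \<omega> c A \<in> carrier_mat D D" unfolding mix_matrix_def using S by auto
  have "transpose_mat (?S 1) = ?S 1" "transpose_mat (?S 2) = ?S 2"
    using A by (auto simp: transpose_mult[of _ D _ _ D])
  moreover have "transpose_mat (a \<cdot>\<^sub>m X) = a \<cdot>\<^sub>m transpose_mat X" for a and X :: "real mat"
    by (intro eq_matI) auto
  ultimately show "transpose_mat (mix_matrix \<omega> c A) = mix_matrix \<omega> c A"
    unfolding mix_matrix_def using S by (subst transpose_add[of _ D D]) auto
qed

text \<open>The columns of \<open>W\<close> need not be eigenvectors themselves. The residual is
  carried over to a matrix \<open>V\<close> of eigenvectors with the same column space, where the
  compressed trace is known.\<close>

lemma residual_top_eigenspace:
  assumes A: "\<forall>i\<in>{1, 2}. A i \<in> carrier_mat D (d i)" and M: "M = mix_matrix \<omega> c A"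
    and W: "W \<in> stiefel D k" and top: "top_eigenspace M k (column_space W)"
  shows "residual \<omega> c A W = mat_trace M - (\<Sum>i<k. eigenvalues_desc M ! i)"
proof -
  note M' = mix_matrix_symmetric[OF A, of \<omega> c, folded M]
  obtain V where V: "V \<in> stiefel D k" "M * V = V * mat_diag k ((!) (eigenvalues_desc M))"
    and eq: "column_space W = column_space V"
    using top unfolding top_eigenspace_iff_stiefel[OF M'(1)] by blast
  have "residual \<omega> c A W = residual \<omega> c A V"
    unfolding residual_def proj_perp_cong_column_space[OF W V(1) eq] ..
  then show ?thesis
    by (simp add: residual_stiefel[OF V(1) A M] mat_trace_eigenvector_compression[OF V(1) M'(1) V(2)])
qed

text \<open>Exhibiting a minimum settles at once that the real infimum is taken over a nonempty set
  bounded below: a top eigenspace provides the member and Ky Fan's bound makes it least.\<close>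

lemma optimal_residual_eq:
  assumes A: "\<forall>i\<in>{1, 2}. A i \<in> carrier_mat D (d i)" and M: "M = mix_matrix \<omega> c A"
    and k: "k \<le> D"
  shows "optimal_residual \<omega> c A D k = mat_trace M - (\<Sum>i<k. eigenvalues_desc M ! i)"
proof -
  note M' = mix_matrix_symmetric[OF A, of \<omega> c, folded M]
  obtain W where W: "W \<in> stiefel D k" "top_eigenspace M k (column_space W)"
    using exists_top_eigenspace[OF M' k] by blast
  show ?thesis unfolding optimal_residual_def
  proof (rule cInf_eq_minimum)
    show "mat_trace M - (\<Sum>i<k. eigenvalues_desc M ! i) \<in> residual \<omega> c A ` stiefel D k"
      by (rule rev_image_eqI[OF W(1)]) (rule residual_top_eigenspace[OF A M W, symmetric])
  qed (use mat_trace_compression_le[OF M' k] residual_stiefel[OF _ A M] in auto)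
qed

lemma residual_eq_0:
  assumes A: "\<forall>i\<in>{1, 2}. A i \<in> carrier_mat D (d i)" and W: "W \<in> stiefel D k"
    and sub: "{u + v |u v. u \<in> column_space (A 1) \<and> v \<in> column_space (A 2)} \<subseteq> column_space W"
  shows "residual \<omega> c A W = 0"
proof -
  \<comment> \<open>As both column spaces contain the zero vector, each of them lies in their sum
    and therefore in the column space of \<open>W\<close>. The projection onto the latter then fixes
    \<open>A 1\<close> and \<open>A 2\<close>.\<close>
  have zero: "0\<^sub>v D \<in> column_space B" if "B \<in> carrier_mat D m" for B m
    using that by (subst vec_space.col_space_eq) (auto intro!: bexI[of _ "0\<^sub>v m"])
  have carrier: "column_space B \<subseteq> carrier_vec D" if "B \<in> carrier_mat D m" for B m
    using that by (subst vec_space.col_space_eq) auto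
  have A': "A 1 \<in> carrier_mat D (d 1)" "A 2 \<in> carrier_mat D (d 2)" using A by auto
  have "u = u + 0\<^sub>v D" "u = 0\<^sub>v D + u" if "u \<in> carrier_vec D" for u :: "real vec"
    using that by auto
  then have "column_space (A 1) \<subseteq> column_space W" "column_space (A 2) \<subseteq> column_space W"
    using sub zero[OF A'(1)] zero[OF A'(2)] carrier[OF A'(1)] carrier[OF A'(2)] by blast+
  then have fixed: "W * transpose_mat W * A i = A i" if "i \<in> {1, 2}" for i
    using that stiefel_projection_fixes[OF W A'(1)] stiefel_projection_fixes[OF W A'(2)] by auto
  have W': "W \<in> carrier_mat D k" using W by (simp add: stiefel_def)
  have "proj_perp W * A i = 0\<^sub>m D (d i)" if i: "i \<in> {1, 2}" for i
  proof -
    have Ai: "A i \<in> carrier_mat D (d i)" using A i by blast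
    have "proj_perp W * A i = 1\<^sub>m D * A i - W * transpose_mat W * A i"
      unfolding proj_perp_def using W' Ai by (subst minus_mult_distrib_mat[of _ D D _ _ "d i"]) auto
    then show ?thesis unfolding fixed[OF i] left_mult_one_mat[OF Ai] using Ai by auto
  qed
  then show ?thesis by (simp add: residual_def frobenius_norm_def)
qed

lemma residual_nonneg:
  assumes "\<forall>i\<in>{1, 2}. \<omega> i > 0" "\<forall>i\<in>{1, 2}. c i > 0"
  shows "residual \<omega> c A W \<ge> 0"
  unfolding residual_def using assms by (intro sum_nonneg mult_nonneg_nonneg) (auto simp: less_imp_le)

text \<open>Ties among eigenvalues can make the top eigenspace nonunique, so attainment is claimed
  for every admissible \<open>W\<close>; the separate existence claim keeps it from being vacuous.
  The sum of the two column spaces is written out as a set of sums of vectors.\<close>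

theorem proposition6:
  fixes D :: nat and d :: "nat \<Rightarrow> nat"
    and A :: "nat \<Rightarrow> real mat" and \<omega> c :: "nat \<Rightarrow> real" and M :: "real mat"
  assumes A_carrier: "\<forall>i\<in>{1, 2}. A i \<in> carrier_mat D (d i)"
    and A_orthonormal: "\<forall>i\<in>{1, 2}. orthonormal_list (cols (A i))"
    and \<omega>_pos: "\<forall>i\<in>{1, 2}. \<omega> i > 0"
    and \<omega>_sum: "\<omega> 1 + \<omega> 2 = 1"
    and c_pos: "\<forall>i\<in>{1, 2}. c i > 0"
    and M_eq: "M = mix_matrix \<omega> c A"
  shows
    "length (eigenvalues_desc M) = D \<and>
     (\<forall>i j. 1 \<le> i \<and> i \<le> j \<and> j \<le> D \<longrightarrow> nth_eigenvalue M j \<le> nth_eigenvalue M i) \<and>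
     (\<forall>j\<in>{1..D}. nth_eigenvalue M j \<ge> 0) \<and>
     (\<forall>k\<in>{max (d 1) (d 2)..D}.
        optimal_residual \<omega> c A D k = mat_trace M - (\<Sum>j = 1..k. nth_eigenvalue M j) \<and>
        mat_trace M - (\<Sum>j = 1..k. nth_eigenvalue M j) = (\<Sum>j = k + 1..D. nth_eigenvalue M j) \<and>
        (\<exists>W\<in>stiefel D k. top_eigenspace M k (column_space W)) \<and>
        (\<forall>W\<in>carrier_mat D k.
           orthonormal_list (cols W) \<and> top_eigenspace M k (column_space W) \<longrightarrow>
             W \<in> stiefel D k \<and> residual \<omega> c A W = optimal_residual \<omega> c A D k \<and>
             ({u + v |u v. u \<in> column_space (A 1) \<and> v \<in> column_space (A 2)} \<subseteq> column_space W
                \<longrightarrow> optimal_residual \<omega> c A D k = 0))) \<and>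
     (\<forall>k\<in>{max (d 1) (d 2)..D}. \<forall>k'\<in>{max (d 1) (d 2)..D}.
        k \<le> k' \<longrightarrow> optimal_residual \<omega> c A D k' \<le> optimal_residual \<omega> c A D k)"
proof -
  let ?es = "eigenvalues_desc M"
  note M = mix_matrix_symmetric[OF A_carrier, of \<omega> c, folded M_eq]
  note es = eigenvalues_desc_real_symmetric[OF M]
  note opt = optimal_residual_eq[OF A_carrier M_eq]
  have mono: "?es ! j \<le> ?es ! i" if "i \<le> j" "j < D" for i j
    using sorted_wrt_nth_less[OF es(3), of i j] that es(2) by (cases "i = j") auto
  \<comment> \<open>In dimension \<open>D - 1\<close> the residual of a top eigenspace is the trace
    minus all eigenvalues but the last, that is, the smallest eigenvalue. The positive weights make
    it nonnegative, and the ordering passes this on to the others.\<close>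
  have nonneg: "0 \<le> ?es ! i" if i: "i < D" for i
  proof -
    obtain W where W: "W \<in> stiefel D (D - 1)" "top_eigenspace M (D - 1) (column_space W)"
      using exists_top_eigenspace[OF M, of "D - 1"] by auto
    have "0 \<le> residual \<omega> c A W" by (rule residual_nonneg[OF \<omega>_pos c_pos])
    also have "\<dots> = (\<Sum>i<Suc (D - 1). ?es ! i) - (\<Sum>i<D - 1. ?es ! i)"
      using i by (simp add: residual_top_eigenspace[OF A_carrier M_eq W]
          mat_trace_eq_sum_eigenvalues[OF M] del: sum.lessThan_Suc)
    finally have "0 \<le> ?es ! (D - 1)" by simp
    also have "\<dots> \<le> ?es ! i" using i by (intro mono) auto
    finally show ?thesis .
  qed
  have top_sum: "(\<Sum>j = 1..k. nth_eigenvalue M j) = (\<Sum>i<k. ?es ! i)" for k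
    by (simp add: sum.atLeast1_atMost_eq nth_eigenvalue_def)
  have tail: "mat_trace M - (\<Sum>j = 1..k. nth_eigenvalue M j) = (\<Sum>j = k + 1..D. nth_eigenvalue M j)"
    if "k \<le> D" for k
  proof -
    have "(\<Sum>j = 1..D. nth_eigenvalue M j) =
        (\<Sum>j = 1..k. nth_eigenvalue M j) + (\<Sum>j = k + 1..D. nth_eigenvalue M j)"
      using sum.ub_add_nat[of 1 k "nth_eigenvalue M" "D - k"] that by simp
    then show ?thesis by (simp add: mat_trace_eq_sum_eigenvalues[OF M] top_sum[symmetric])
  qed
  have nonneg': "nth_eigenvalue M j \<ge> 0" if "j \<in> {1..D}" for j
    unfolding nth_eigenvalue_def using that by (intro nonneg) auto
  have opt_tail: "optimal_residual \<omega> c A D k = (\<Sum>j = k + 1..D. nth_eigenvalue M j)"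
    if "k \<le> D" for k
    using opt[OF that] tail[OF that] by (simp only: top_sum)
  \<comment> \<open>As \<open>k\<close> grows, the tail sum loses only nonnegative terms.\<close>
  have antimono: "optimal_residual \<omega> c A D k' \<le> optimal_residual \<omega> c A D k"
    if "k \<le> k'" "k' \<le> D" for k k'
  proof -
    have k: "k \<le> D" using that by simp
    show ?thesis
      unfolding opt_tail[OF k] opt_tail[OF that(2)]
      using that nonneg' by (intro sum_mono2) auto
  qed
  have attained: "W \<in> stiefel D k \<and> residual \<omega> c A W = optimal_residual \<omega> c A D k \<and>
      ({u + v |u v. u \<in> column_space (A 1) \<and> v \<in> column_space (A 2)} \<subseteq> column_space W
        \<longrightarrow> optimal_residual \<omega> c A D k = 0)"
    if k: "k \<le> D" and W: "W \<in> carrier_mat D k" "orthonormal_list (cols W)"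
      "top_eigenspace M k (column_space W)" for k W
  proof -
    have st: "W \<in> stiefel D k" using orthonormal_cols_iff[OF W(1)] W(2) by simp
    have "residual \<omega> c A W = optimal_residual \<omega> c A D k"
      unfolding opt[OF k] by (rule residual_top_eigenspace[OF A_carrier M_eq st W(3)])
    then show ?thesis using st residual_eq_0[OF A_carrier st, of \<omega> c] by simp
  qed
  have sorted: "nth_eigenvalue M j \<le> nth_eigenvalue M i" if "1 \<le> i" "i \<le> j" "j \<le> D" for i j
    unfolding nth_eigenvalue_def using that by (intro mono) auto
  show ?thesis
  proof (intro conjI ballI allI impI)
    fix k assume "k \<in> {max (d 1) (d 2)..D}"
    then have k: "k \<le> D" by simp
    show "optimal_residual \<omega> c A D k = mat_trace M - (\<Sum>j = 1..k. nth_eigenvalue M j)"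
      unfolding opt[OF k] top_sum ..
    show "mat_trace M - (\<Sum>j = 1..k. nth_eigenvalue M j) = (\<Sum>j = k + 1..D. nth_eigenvalue M j)"
      by (rule tail[OF k])
    show "\<exists>W\<in>stiefel D k. top_eigenspace M k (column_space W)"
      by (rule exists_top_eigenspace[OF M k])
    fix W assume "W \<in> carrier_mat D k" "orthonormal_list (cols W) \<and> top_eigenspace M k (column_space W)"
    then show "W \<in> stiefel D k" "residual \<omega> c A W = optimal_residual \<omega> c A D k"
      "{u + v |u v. u \<in> column_space (A 1) \<and> v \<in> column_space (A 2)} \<subseteq> column_space W
        \<Longrightarrow> optimal_residual \<omega> c A D k = 0"
      using attained[OF k] by blast+
  qed (use es(2) sorted nonneg' antimono in auto)
qed

end
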